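(* Suppose $G$ is a non-cyclic group. Then $G$ is finite if and only if $G$ contains only finitely many non-power subgroups.
   Context: For a group $G$ (not necessarily finite or abelian) and a non-negative integer $m$, $G^{m}=\langle g^{m} \mid g\in G\rangle$ denotes the subgroup of $G$ generated by all $m$-th powers of elements of $G$ (so $G^{0}=\{1\}$ and $G^{1}=G$). A subgroup $H$ of $G$ is called a power subgroup of $G$ if there exists a non-negative integer $m$ such that $H=G^{m}$. A subgroup $H$ of $G$ is called a non-power subgroup of $G$ if $H\neq G^{m}$ for all non-negative integers $m$. *)

theory Defs
  imports "HOL-Algebra.Algebra"
begin

definition group_power :: "('a, 'b) monoid_scheme \<Rightarrow> nat \<Rightarrow> 'a set"
  where "group_power G m = generate G {g [^]\<^bsub>G\<^esub> m | g. g \<in> carrier G}"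

definition power_subgroup :: "'a set \<Rightarrow> ('a, 'b) monoid_scheme \<Rightarrow> bool"
  where "power_subgroup H G \<longleftrightarrow> subgroup H G \<and> (\<exists>m. H = group_power G m)"

definition non_power_subgroup :: "'a set \<Rightarrow> ('a, 'b) monoid_scheme \<Rightarrow> bool"
  where "non_power_subgroup H G \<longleftrightarrow> subgroup H G \<and> (\<forall>m. H \<noteq> group_power G m)"

lemma (in group) subgroup_group_power: "subgroup (group_power G m) G"
  unfolding group_power_def by (rule generate_is_subgroup) auto

lemma (in group) group_power_0: "group_power G 0 = {\<one>}"
proof -
  have "{g [^] (0::nat) | g. g \<in> carrier G} = {\<one>}" by auto
  then show ?thesis by (simp add: group_power_def generate_one)
qed

lemma (in group) group_power_1: "group_power G 1 = carrier G"
proof -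
  have "{g [^] (1::nat) | g. g \<in> carrier G} = carrier G" by force
  then show ?thesis
    unfolding group_power_def
    by (metis generate_incl generate.incl order_refl subsetI subset_antisym)
qed

lemma (in group) non_power_subgroup_iff:
  "non_power_subgroup H G \<longleftrightarrow> subgroup H G \<and> \<not> power_subgroup H G"
  by (auto simp: non_power_subgroup_def power_subgroup_def)

end

theory Submission
  imports Defs
begin

text \<open>
  Suppose that the infinite group \<open>G\<close> has only finitely many non-power subgroups. If \<open>G\<close> is torsion,
  it has infinitely many cyclic subgroups, so some nontrivial finite cyclic subgroup is \<open>G\<^sup>m\<close>
  with \<open>m > 0\<close>; then \<open>G\<close> has finite exponent \<open>e\<close>, and since \<open>G\<^sup>k\<close> depends only on \<open>k mod e\<close> there
  are finitely many subgroups altogether, a contradiction.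

  Otherwise let \<open>x\<close> have infinite order. Power subgroups are normal, so \<open>\<langle>x\<^sup>n\<rangle>\<close> and \<open>\<langle>x\<^sup>n\<^sup>+\<^sup>1\<rangle>\<close> are
  normal for some \<open>n\<close>, and hence so is \<open>\<langle>x\<rangle>\<close>. An element \<open>g\<close> inverting \<open>x\<close> would give the infinitely
  many non-normal subgroups \<open>\<langle>g x\<^sup>n\<rangle>\<close>, so \<open>x\<close> is central. As the elements of infinite order generate
  \<open>G\<close>, the group is abelian. Now some \<open>\<langle>x\<^sup>n\<rangle>\<close> equals \<open>G\<^sup>m\<close>; pick \<open>z\<close> with \<open>z\<^sup>m = x\<^sup>n\<close>. Infinitely many
  \<open>n \<equiv> 1 (mod m)\<close> make \<open>\<langle>z\<^sup>n\<rangle>\<close> a power subgroup \<open>G\<^sup>b\<close>, and then \<open>b = n\<close>, so \<open>\<langle>z\<^sup>n\<rangle>\<close> contains all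
  \<open>t\<close> with \<open>t\<^sup>m = 1\<close>, whence \<open>t = 1\<close> and \<open>G = \<langle>z\<rangle>\<close>.
\<close>

context group
begin

section \<open>Cyclic subgroups, conjugation and power subgroups\<close>

abbreviation powers :: "'a \<Rightarrow> 'a set"
  where "powers x \<equiv> range (\<lambda>k::int. x [^] k)"

lemma self_in_powers: "x \<in> carrier G \<Longrightarrow> x \<in> powers x"
  by (metis int_pow_1 rangeI)

lemma powers_commute:
  assumes "x \<in> carrier G" "y \<in> powers x"
  shows "x \<otimes> y = y \<otimes> x"
proof -
  obtain k :: int where "y = x [^] k" using assms by blast
  then show ?thesis
    by (metis assms(1) add.commute int_pow_1 int_pow_mult)
qed

lemma conj_int_pow:
  assumes "g \<in> carrier G" "x \<in> carrier G"
  shows "(g \<otimes> x \<otimes> inv g) [^] (k::int) = g \<otimes> x [^] k \<otimes> inv g"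
proof -
  have "(\<lambda>h. g \<otimes> h \<otimes> inv g) \<in> hom G G"
    using assms(1) by (auto simp: hom_def m_assoc inv_solve_left)
  from hom_int_pow[OF this assms(2) is_group is_group] show ?thesis by simp
qed

lemma group_power_normal: "group_power G m \<lhd> G"
  unfolding group_power_def
proof (rule normal_generateI)
  fix h g assume h: "h \<in> {g [^] m | g. g \<in> carrier G}" and g: "g \<in> carrier G"
  then obtain x where x: "x \<in> carrier G" "h = x [^] m" by auto
  then have "g \<otimes> h \<otimes> inv g = (g \<otimes> x \<otimes> inv g) [^] m"
    using conj_int_pow[OF g x(1), of "int m"] by (simp add: int_pow_int)
  then show "g \<otimes> h \<otimes> inv g \<in> {g [^] m | g. g \<in> carrier G}"
    using g x(1) by blast
qed auto

lemma pow_in_group_power: "g \<in> carrier G \<Longrightarrow> g [^] m \<in> group_power G m"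
  unfolding group_power_def by (rule generate.incl) blast

lemma group_power_mod:
  assumes "\<And>g. g \<in> carrier G \<Longrightarrow> g [^] (e::nat) = \<one>"
  shows "group_power G k = group_power G (k mod e)"
proof -
  have "g [^] k = g [^] (k mod e)" if "g \<in> carrier G" for g
  proof -
    have "g [^] k = g [^] (e * (k div e) + k mod e)" by simp
    also have "\<dots> = (g [^] e) [^] (k div e) \<otimes> g [^] (k mod e)"
      using that by (simp only: nat_pow_mult nat_pow_pow nat_pow_closed)
    finally show ?thesis using that assms by simp
  qed
  then have "{g [^] k | g. g \<in> carrier G} = {g [^] (k mod e) | g. g \<in> carrier G}"
    by (intro Collect_cong) metis
  then show ?thesis by (simp add: group_power_def)
qed

lemma int_pow_eq_infinite:
  assumes "x \<in> carrier G" "ord x = 0"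
  shows "x [^] (i::int) = x [^] j \<longleftrightarrow> i = j"
  using assms int_pow_eq[of x i j] by auto

lemma infinite_order_int_pow:
  assumes "x \<in> carrier G" "ord x = 0" "n \<noteq> 0"
  shows "ord (x [^] (n::int)) = 0"
proof -
  have "(x [^] n) [^] k \<noteq> \<one>" if "k \<noteq> 0" for k :: nat
  proof -
    have "(x [^] n) [^] k = x [^] (n * int k)"
      using assms(1) by (metis int_pow_int int_pow_pow)
    then show ?thesis
      using assms that int_pow_eq_id[of x "n * int k"] by simp
  qed
  then show ?thesis using assms ord_eq_0 by auto
qed

text \<open>One of these subgroups lies in another only if the exponents divide each other
  accordingly, and natural numbers dividing each other are equal.\<close>

lemma inj_powers_int_pow:
  assumes "x \<in> carrier G" "ord x = 0"
  shows "inj_on (\<lambda>n::nat. powers (x [^] int n)) UNIV"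
proof (rule inj_onI)
  have dvd: "int n dvd int k" if "powers (x [^] int k) \<subseteq> powers (x [^] int n)" for n k :: nat
  proof -
    have "x [^] int k \<in> powers (x [^] int n)"
      using that self_in_powers[of "x [^] int k"] assms(1) by auto
    then obtain i :: int where "x [^] int k = x [^] (int n * i)"
      using assms(1) by (auto simp: int_pow_pow)
    then show ?thesis using int_pow_eq_infinite[OF assms] by auto
  qed
  fix n k :: nat assume "powers (x [^] int n) = powers (x [^] int k)"
  then have "int n dvd int k" "int k dvd int n" using dvd by blast+
  then show "n = k" by (simp add: dvd_antisym)
qed

section \<open>Torsion groups\<close>

lemma finite_carrier_if_finite_cyclic_subgroups:
  assumes "finite (powers ` carrier G)" and "\<And>x. x \<in> carrier G \<Longrightarrow> ord x \<noteq> 0"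
  shows "finite (carrier G)"
proof -
  have "finite (powers x)" if "x \<in> carrier G" for x
    using assms(2)[OF that] finite_cyclic_subgroup_order[OF that]
      carrier_subgroup_generated_by_singleton[OF that] by simp
  then have "finite (\<Union> (powers ` carrier G))" using assms(1) by blast
  moreover have "carrier G \<subseteq> \<Union> (powers ` carrier G)" using self_in_powers by blast
  ultimately show ?thesis by (rule rev_finite_subset)
qed

lemma torsion_finite:
  assumes fin: "finite {H. non_power_subgroup H G}"
    and tor: "\<And>x. x \<in> carrier G \<Longrightarrow> ord x \<noteq> 0"
  shows "finite (carrier G)"
proof (rule finite_carrier_if_finite_cyclic_subgroups[OF _ tor])
  show "finite (powers ` carrier G)"
  proof (rule ccontr)
    assume inf: "infinite (powers ` carrier G)"
    \<comment> \<open>The trivial subgroup is set aside because it is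
      \<open>group_power G 0\<close>, while \<open>e\<close> below is positive only if
      \<open>m > 0\<close>.\<close>
    have "finite ({H. non_power_subgroup H G} \<union> {{\<one>}})" using fin by simp
    then have "\<not> powers ` carrier G \<subseteq> {H. non_power_subgroup H G} \<union> {{\<one>}}"
      using inf finite_subset by blast
    then obtain x where x: "x \<in> carrier G" "\<not> non_power_subgroup (powers x) G" "powers x \<noteq> {\<one>}"
      by blast
    then obtain m where m: "powers x = group_power G m"
      using subgroup_of_powers[OF x(1)] by (auto simp: non_power_subgroup_def)
    have "m \<noteq> 0" using x(3) m group_power_0 by metis
    define e where "e = m * ord x"
    have "e > 0" using \<open>m \<noteq> 0\<close> tor[OF x(1)] by (simp add: e_def)
    have exponent: "g [^] e = \<one>" if g: "g \<in> carrier G" for g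
    proof -
      obtain k :: int where k: "g [^] m = x [^] k"
        using pow_in_group_power[OF g, of m] m by auto
      have "g [^] e = (x [^] k) [^] int (ord x)"
        using g by (simp add: e_def int_pow_int flip: nat_pow_pow k)
      also have "\<dots> = \<one>" using x(1) by (simp add: int_pow_pow int_pow_eq_id)
      finally show ?thesis .
    qed
    have "{H. subgroup H G} \<subseteq> {H. non_power_subgroup H G} \<union> group_power G ` {..<e}"
    proof
      fix H assume "H \<in> {H. subgroup H G}"
      moreover have "group_power G k \<in> group_power G ` {..<e}" for k
        using group_power_mod[OF exponent, of k] \<open>e > 0\<close> by auto
      ultimately show "H \<in> {H. non_power_subgroup H G} \<union> group_power G ` {..<e}"
        by (auto simp: non_power_subgroup_def)
    qed
    then have "finite {H. subgroup H G}" using fin finite_subset by blast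
    moreover have "powers ` carrier G \<subseteq> {H. subgroup H G}" using subgroup_of_powers by blast
    ultimately show False using inf finite_subset by blast
  qed
qed

section \<open>Elements of infinite order: conjugation and centrality\<close>

lemma finite_non_power_indices:
  assumes fin: "finite {H. non_power_subgroup H G}"
    and inj: "inj_on f (UNIV::nat set)" and sub: "\<And>n. subgroup (f n) G"
  shows "finite {n. \<nexists>m. f n = group_power G m}"
proof (rule inj_on_finite)
  \<comment> \<open>Indices of non-power subgroups inject into a finite set, so from some index on,
    every \<open>f n\<close> is a power subgroup.\<close>
  show "inj_on f {n. \<nexists>m. f n = group_power G m}" using inj inj_on_subset by blast
  show "f ` {n. \<nexists>m. f n = group_power G m} \<subseteq> {H. non_power_subgroup H G}"
    using sub by (auto simp: non_power_subgroup_def)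
qed (rule fin)

lemma infinite_order_conj_in_powers:
  assumes fin: "finite {H. non_power_subgroup H G}"
    and x: "x \<in> carrier G" "ord x = 0" and g: "g \<in> carrier G"
  shows "g \<otimes> x \<otimes> inv g \<in> powers x"
proof -
  have "finite {n. \<nexists>m. powers (x [^] int n) = group_power G m}"
    using finite_non_power_indices[OF fin inj_powers_int_pow[OF x]] x(1)
    by (simp add: subgroup_of_powers)
  then obtain N where "\<forall>n \<in> {n. \<nexists>m. powers (x [^] int n) = group_power G m}. n < N"
    unfolding finite_nat_set_iff_bounded by blast
  then have N: "\<exists>m. powers (x [^] int n) = group_power G m" if "n \<ge> N" for n
    using that leD by blast
  have *: "\<exists>i. (g \<otimes> x \<otimes> inv g) [^] int n = x [^] (i::int)" if n: "n \<ge> N" for n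
  proof -
    from N[OF n] obtain m where m: "powers (x [^] int n) = group_power G m" by blast
    interpret normal "powers (x [^] int n)" G unfolding m by (rule group_power_normal)
    have "(g \<otimes> x \<otimes> inv g) [^] int n \<in> powers (x [^] int n)"
      using inv_op_closed2[OF g self_in_powers] x(1) g by (simp add: conj_int_pow)
    then show ?thesis using x(1) by (auto simp: int_pow_pow)
  qed
  \<comment> \<open>Two consecutive exponents suffice: the conjugate of \<open>x\<close> is the
    quotient of its powers with exponents \<open>Suc N\<close> and \<open>N\<close>.\<close>
  obtain i j :: int where i: "(g \<otimes> x \<otimes> inv g) [^] int N = x [^] i"
    and j: "(g \<otimes> x \<otimes> inv g) [^] int (Suc N) = x [^] j"
    using *[of N] *[of "Suc N"] by auto
  have "g \<otimes> x \<otimes> inv g = (g \<otimes> x \<otimes> inv g) [^] (int (Suc N) - int N)"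
    using x(1) g by simp
  also have "\<dots> = x [^] (j - i)"
    using x(1) g i j by (simp only: int_pow_diff m_closed inv_closed)
  finally show ?thesis by blast
qed

text \<open>Conjugation by \<open>g\<close> and by \<open>inv g\<close> raise \<open>x\<close> to
  exponents \<open>a\<close> and \<open>b\<close>. They undo each other, so \<open>a * b = 1\<close>
  in the integers.\<close>

lemma infinite_order_conj_cases:
  assumes fin: "finite {H. non_power_subgroup H G}"
    and x: "x \<in> carrier G" "ord x = 0" and g: "g \<in> carrier G"
  shows "g \<otimes> x \<otimes> inv g = x \<or> g \<otimes> x \<otimes> inv g = inv x"
proof -
  obtain a :: int where a: "g \<otimes> x \<otimes> inv g = x [^] a"
    using infinite_order_conj_in_powers[OF fin x g] by blast
  obtain b :: int where b: "inv g \<otimes> x \<otimes> g = x [^] b"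
    using infinite_order_conj_in_powers[OF fin x inv_closed[OF g]] g by auto
  have "x = g \<otimes> (inv g \<otimes> x \<otimes> g) \<otimes> inv g"
    using x(1) g by (simp add: m_assoc) (simp flip: m_assoc)
  also have "\<dots> = (g \<otimes> x \<otimes> inv g) [^] b" using x(1) g by (simp only: b conj_int_pow)
  also have "\<dots> = x [^] (a * b)" using x(1) by (simp only: a int_pow_pow)
  finally have "a * b = 1"
    using int_pow_eq_infinite[OF x, of 1 "a * b"] x(1) by simp
  then have "a = 1 \<or> a = -1" using zmult_eq_1_iff by blast
  then show ?thesis using a x(1) int_pow_neg[of x 1] by auto
qed

text \<open>A power of \<open>g\<close> is fixed under conjugation by \<open>g\<close>, whereas a
  power of \<open>x\<close> is inverted.\<close>

lemma inverting_powers_trivial: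
  assumes x: "x \<in> carrier G" "ord x = 0" and g: "g \<in> carrier G"
    and inv: "g \<otimes> x \<otimes> inv g = inv x" and "x [^] (k::int) \<in> powers g"
  shows "k = 0"
proof -
  have "g \<otimes> x [^] k = x [^] k \<otimes> g" using powers_commute g assms(5) by blast
  then have "x [^] k = g \<otimes> x [^] k \<otimes> inv g" using x g by (simp add: m_assoc)
  also have "\<dots> = x [^] (-k)"
    using x(1) g inv by (simp add: int_pow_inv int_pow_neg flip: conj_int_pow)
  finally show ?thesis using int_pow_eq_infinite[OF x] by auto
qed

text \<open>Normality would put the commutator of \<open>x\<close> and \<open>g\<close> into
  \<open>powers g\<close>; this commutator is the square of \<open>x\<close>.\<close>

lemma inverting_powers_not_normal:
  assumes x: "x \<in> carrier G" "ord x = 0" and g: "g \<in> carrier G"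
    and inv: "g \<otimes> x \<otimes> inv g = inv x"
  shows "\<not> powers g \<lhd> G"
proof
  assume "powers g \<lhd> G"
  then interpret normal "powers g" G .
  have gg: "g \<in> powers g" using g by (rule self_in_powers)
  have "x \<otimes> g \<otimes> inv x \<otimes> inv g \<in> powers g"
    using inv_op_closed2[OF x(1) gg] gg by (meson m_closed m_inv_closed)
  moreover have "g \<otimes> inv x \<otimes> inv g = x"
    using conj_int_pow[OF g x(1), of "-1"] x(1) inv g by (simp add: int_pow_neg)
  then have "x \<otimes> g \<otimes> inv x \<otimes> inv g = x [^] (2::int)"
    using x(1) g int_pow_mult[OF x(1), of 1 1] by (simp add: m_assoc)
  ultimately show False using inverting_powers_trivial[OF x g inv, of 2] by simp
qed

lemma infinite_order_central:
  assumes fin: "finite {H. non_power_subgroup H G}"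
    and x: "x \<in> carrier G" "ord x = 0" and g: "g \<in> carrier G"
  shows "g \<otimes> x = x \<otimes> g"
proof -
  have "g \<otimes> x \<otimes> inv g \<noteq> inv x"
  proof
    assume inv: "g \<otimes> x \<otimes> inv g = inv x"
    \<comment> \<open>Since powers of \<open>x\<close> commute with \<open>x\<close>, every
      \<open>h n\<close> inverts \<open>x\<close> just as \<open>g\<close> does.\<close>
    define h where "h n = g \<otimes> x [^] int n" for n
    have h: "h n \<in> carrier G" for n using x g by (simp add: h_def)
    have hinv: "h n \<otimes> x \<otimes> inv (h n) = inv x" for n
    proof -
      have "x [^] int n \<otimes> x = x \<otimes> x [^] int n"
        using powers_commute x(1) by (metis rangeI)
      then have "x [^] int n \<otimes> x \<otimes> inv (x [^] int n) = x"
        using x(1) by (simp add: m_assoc)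
      moreover have "h n \<otimes> x \<otimes> inv (h n) = g \<otimes> (x [^] int n \<otimes> x \<otimes> inv (x [^] int n)) \<otimes> inv g"
        using x(1) g by (simp add: h_def m_assoc inv_mult_group)
      ultimately show ?thesis using inv by simp
    qed
    have "inj_on (\<lambda>n. powers (h n)) UNIV"
    proof (rule inj_onI)
      fix n k assume eq: "powers (h n) = powers (h k)"
      interpret subgroup "powers (h n)" G using h by (rule subgroup_of_powers)
      \<comment> \<open>Equal subgroups contain this quotient of their generators. It is a power of
        \<open>x\<close>, hence trivial.\<close>
      have "inv (h k) \<otimes> h n \<in> powers (h n)"
        using self_in_powers[OF h[of n]] self_in_powers[OF h[of k]] eq by (metis m_closed m_inv_closed)
      moreover have "h n = h k \<otimes> x [^] (- int k + int n)"
        using x(1) g int_pow_mult[OF x(1), of "int k" "- int k + int n"]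
        by (simp add: h_def m_assoc)
      then have "inv (h k) \<otimes> h n = x [^] (- int k + int n)"
        by (rule iffD2[OF inv_solve_left'[OF int_pow_closed[OF x(1)] h h]])
      ultimately have "x [^] (- int k + int n) \<in> powers (h n)" by simp
      from inverting_powers_trivial[OF x h hinv this] show "n = k" by simp
    qed
    then have "finite {n. \<nexists>m. powers (h n) = group_power G m}"
      using finite_non_power_indices[OF fin] subgroup_of_powers[OF h] by blast
    moreover have "powers (h n) \<noteq> group_power G m" for n m
    proof
      assume "powers (h n) = group_power G m"
      then have "powers (h n) \<lhd> G" by (simp only: group_power_normal)
      with inverting_powers_not_normal[OF x h hinv] show False ..
    qed
    ultimately show False by simp
  qed
  then have "g \<otimes> x \<otimes> inv g = x" using infinite_order_conj_cases[OF fin x g] by blast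
  then show ?thesis using x g by (metis inv_solve_right m_closed)
qed

text \<open>If \<open>a\<close> has finite order, then \<open>a \<otimes> x\<close> has infinite
  order. So \<open>b\<close> commutes with \<open>a \<otimes> x\<close> and with \<open>x\<close>,
  hence with \<open>a\<close>.\<close>

lemma infinite_order_comm_group:
  assumes fin: "finite {H. non_power_subgroup H G}"
    and x: "x \<in> carrier G" "ord x = 0"
  shows "comm_group G"
proof (rule group_comm_groupI)
  fix a b assume a: "a \<in> carrier G" and b: "b \<in> carrier G"
  show "a \<otimes> b = b \<otimes> a"
  proof (cases "ord a = 0")
    case True
    then show ?thesis using infinite_order_central[OF fin a _ b] by simp
  next
    case False
    have comm: "a \<otimes> x = x \<otimes> a" using infinite_order_central[OF fin x a] .
    have "ord (a \<otimes> x) = 0"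
    proof (rule ccontr)
      \<comment> \<open>A common multiple of both orders kills \<open>a\<close> and
        \<open>a \<otimes> x\<close>, hence also \<open>x\<close>.\<close>
      let ?n = "ord (a \<otimes> x) * ord a"
      assume "ord (a \<otimes> x) \<noteq> 0"
      then have "?n \<noteq> 0" using False by simp
      have "x [^] ?n = a [^] ?n \<otimes> x [^] ?n" using a x(1) by (simp add: pow_eq_id)
      also have "\<dots> = (a \<otimes> x) [^] ?n" using pow_mult_distrib[OF comm a x(1)] by simp
      also have "\<dots> = \<one>" using a x(1) by (simp add: pow_eq_id)
      finally have "x [^] ?n = \<one>" .
      then show False using x \<open>?n \<noteq> 0\<close> by (simp add: pow_eq_id)
    qed
    then have "b \<otimes> (a \<otimes> x) = (a \<otimes> x) \<otimes> b"
      using infinite_order_central[OF fin _ _ b] a x by simp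
    also have "\<dots> = a \<otimes> b \<otimes> x"
      using infinite_order_central[OF fin x b] a b x(1) by (simp add: m_assoc)
    finally show ?thesis using a b x(1) by (simp flip: m_assoc)
  qed
qed

section \<open>Abelian groups with an element of infinite order\<close>

lemma (in comm_group) group_power_eq: "group_power G m = {g [^] m | g. g \<in> carrier G}"
proof -
  have "subgroup {g [^] m | g. g \<in> carrier G} G"
  proof (rule subgroupI)
    fix a b assume "a \<in> {g [^] m | g. g \<in> carrier G}" "b \<in> {g [^] m | g. g \<in> carrier G}"
    then obtain g h where gh: "g \<in> carrier G" "h \<in> carrier G" "a = g [^] m" "b = h [^] m" by auto
    then have "a \<otimes> b = (g \<otimes> h) [^] m" "inv a = inv g [^] m"
      by (simp_all add: nat_pow_distrib nat_pow_inv)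
    then show "a \<otimes> b \<in> {g [^] m | g. g \<in> carrier G}" "inv a \<in> {g [^] m | g. g \<in> carrier G}"
      using gh by auto
  qed auto
  then show ?thesis
    unfolding group_power_def using generateI by blast
qed

lemma (in comm_group) infinite_order_cyclic_group:
  assumes fin: "finite {H. non_power_subgroup H G}"
    and x: "x \<in> carrier G" "ord x = 0"
  shows "cyclic_group G"
proof -
  have ev: "finite {n. \<nexists>m. powers (u [^] int n) = group_power G m}"
    if "u \<in> carrier G" "ord u = 0" for u
    using finite_non_power_indices[OF fin inj_powers_int_pow] that
    by (simp add: subgroup_of_powers)
  \<comment> \<open>The index 0 is excluded as well, so that \<open>y\<close> below has infinite
    order.\<close>
  from ev[OF x] have "finite ({n. \<nexists>m. powers (x [^] int n) = group_power G m} \<union> {0})" by simp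
  then obtain n where n: "n \<notin> {n. \<nexists>m. powers (x [^] int n) = group_power G m} \<union> {0}"
    using ex_new_if_finite infinite_UNIV_nat by blast
  then obtain m where m: "powers (x [^] int n) = group_power G m" and "n \<noteq> 0" by auto
  define y where "y = x [^] int n"
  have y: "y \<in> carrier G" "ord y = 0"
    using x \<open>n \<noteq> 0\<close> infinite_order_int_pow[of x "int n"] by (auto simp: y_def)
  have "y \<in> group_power G m" using self_in_powers[OF y(1)] m y_def by simp
  then obtain z where z: "z \<in> carrier G" "y = z [^] m" unfolding group_power_eq by auto
  have "m \<noteq> 0"
  proof
    assume "m = 0"
    then have "y = \<one>" using z by simp
    then show False using y(2) by simp
  qed
  have ordz: "ord z = 0"
  proof (rule ccontr)
    assume "ord z \<noteq> 0"
    moreover have "y [^] ord z = \<one>" using z by (simp add: nat_pow_pow pow_eq_id)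
    ultimately show False using y by (simp add: pow_eq_id)
  qed
  \<comment> \<open>Exponents congruent to 1 modulo \<open>m\<close> are chosen because
    \<open>t [^] q = t\<close> whenever \<open>t [^] m = \<one>\<close>.\<close>
  have "inj (\<lambda>k. 1 + m * k)" using \<open>m \<noteq> 0\<close> by (auto simp: inj_on_def)
  then have "infinite (range (\<lambda>k. 1 + m * k))" using range_inj_infinite by blast
  then have "\<not> range (\<lambda>k. 1 + m * k) \<subseteq> {n. \<nexists>m. powers (z [^] int n) = group_power G m}"
    using ev[OF z(1) ordz] finite_subset by blast
  then obtain q k b where q: "q = 1 + m * k" and b: "powers (z [^] int q) = group_power G b"
    by blast
  have "z [^] b \<in> powers (z [^] int q)" using b pow_in_group_power z(1) by simp
  then obtain i :: int where "z [^] b = z [^] (int q * i)"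
    using z(1) by (auto simp: int_pow_pow)
  then have "int b = int q * i"
    using int_pow_eq_infinite[OF z(1) ordz, of "int b" "int q * i"] by (simp add: int_pow_int)
  then have "q dvd b" by (metis dvd_triv_left int_dvd_int_iff)
  have "z [^] int q \<in> group_power G b" using b self_in_powers[of "z [^] int q"] z(1) by auto
  then obtain h where h: "h \<in> carrier G" "z [^] q = h [^] b"
    unfolding group_power_eq by (auto simp: int_pow_int)
  obtain j :: int where j: "h [^] m = y [^] j"
    using pow_in_group_power[OF h(1), of m] m y_def by auto
  \<comment> \<open>Taking \<open>m\<close>-th powers in \<open>z [^] q = h [^] b\<close> moves the
    equation into \<open>powers y\<close>, where exponents can be compared.\<close>
  have "y [^] int q = (z [^] q) [^] m"
    using z by (simp add: int_pow_int nat_pow_pow mult.commute)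
  also have "\<dots> = (h [^] m) [^] b" using h by (simp add: nat_pow_pow mult.commute)
  also have "\<dots> = y [^] (j * int b)" using y(1) j by (metis int_pow_int int_pow_pow)
  finally have "int q = j * int b" using int_pow_eq_infinite[OF y] by blast
  then have "b dvd q" by (metis dvd_triv_right int_dvd_int_iff)
  with \<open>q dvd b\<close> have "b = q" by (rule dvd_antisym[symmetric])
  have torsion: "t = \<one>" if t: "t \<in> carrier G" "t [^] m = \<one>" for t
  proof -
    have "t [^] q = t" using t by (simp add: q nat_pow_Suc2 flip: nat_pow_pow nat_pow_mult)
    then have "t \<in> powers (z [^] int q)" using b \<open>b = q\<close> pow_in_group_power[OF t(1), of q] by simp
    then obtain i :: int where i: "t = z [^] i" using z(1) by (auto simp: int_pow_pow)
    then have "z [^] (i * int m) = \<one>" using t(2) z(1) by (metis int_pow_int int_pow_pow)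
    then have "i = 0" using int_pow_eq_infinite[OF z(1) ordz, of "i * int m" 0] \<open>m \<noteq> 0\<close> by simp
    then show ?thesis using i by simp
  qed
  have "g \<in> powers z" if g: "g \<in> carrier G" for g
  proof -
    obtain i :: int where i: "g [^] m = y [^] i"
      using pow_in_group_power[OF g, of m] m y_def by auto
    \<comment> \<open>Both \<open>g\<close> and \<open>z [^] i\<close> have \<open>m\<close>-th
      power \<open>y [^] i\<close>, so their quotient is killed by \<open>m\<close> and thus
      trivial.\<close>
    have "(g \<otimes> inv (z [^] i)) [^] m = g [^] m \<otimes> inv ((z [^] i) [^] m)"
      using g z(1) by (simp add: nat_pow_distrib nat_pow_inv)
    also have "(z [^] i) [^] m = y [^] i"
      using z by (metis int_pow_int int_pow_pow mult.commute)
    finally have "(g \<otimes> inv (z [^] i)) [^] m = \<one>" using i y(1) by simp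
    then have "g \<otimes> inv (z [^] i) = \<one>" using torsion g z(1) by simp
    then have "g = z [^] i" using g z(1) by (metis int_pow_closed inv_equality inv_closed inv_inv)
    then show ?thesis by blast
  qed
  then have "carrier G = powers z" using z(1) by auto
  then show ?thesis using z(1) cyclic_group by blast
qed

end

theorem mainTheorem2:
  fixes G :: "('a, 'b) monoid_scheme"
  assumes "group G"
    and "\<not> cyclic_group G"
  shows "finite (carrier G) \<longleftrightarrow> finite {H. non_power_subgroup H G}"
proof
  assume "finite (carrier G)"
  then have "finite (Pow (carrier G))" by simp
  moreover have "{H. non_power_subgroup H G} \<subseteq> Pow (carrier G)"
  proof
    fix H assume "H \<in> {H. non_power_subgroup H G}"
    then have "subgroup H G" by (simp add: non_power_subgroup_def)
    then show "H \<in> Pow (carrier G)" by (intro PowI subgroup.subset)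
  qed
  ultimately show "finite {H. non_power_subgroup H G}" by (rule rev_finite_subset)
next
  assume fin: "finite {H. non_power_subgroup H G}"
  interpret group G by fact
  have "ord x \<noteq> 0" if x: "x \<in> carrier G" for x
  proof
    assume "ord x = 0"
    then interpret comm_group G by (rule infinite_order_comm_group[OF fin x])
    from \<open>ord x = 0\<close> have "cyclic_group G" by (rule infinite_order_cyclic_group[OF fin x])
    with assms(2) show False ..
  qed
  then show "finite (carrier G)" by (rule torsion_finite[OF fin])
qed

end
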